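(* Let $t\ge 2$, let $\mathcal{M}=(E_t,\mathcal{T})$ be a simple oriented matroid on the ground set $E_t=\{1,\ldots,t\}$ with set of topes $\mathcal{T}\subseteq\{1,-1\}^t$, and let $\mathfrak{V}(\boldsymbol{R})=(R^0,R^1,\ldots,R^{2t-1})$ be the vertex sequence of a symmetric cycle $\boldsymbol{R}$ in the tope graph of $\mathcal{M}$. If $T$ is a tope of $\mathcal{M}$, then for the inclusion-minimal subset $\boldsymbol{Q}(T,\boldsymbol{R})\subset\mathfrak{V}(\boldsymbol{R})$ such that $T=\sum_{Q\in\boldsymbol{Q}(T,\boldsymbol{R})}Q$, we have $$|\boldsymbol{Q}(T,\boldsymbol{R})|=t-\tfrac14\bigl(a_{T,\boldsymbol{R}}(0)-a_{T,\boldsymbol{R}}(2)\bigr),$$ $$|\boldsymbol{Q}(T,\boldsymbol{R})|=\tfrac14\bigl(3a_{T,\boldsymbol{R}}(0)-4a_{T,\boldsymbol{R}}(1)+a_{T,\boldsymbol{R}}(2)\bigr),$$ $$|\boldsymbol{Q}(T,\boldsymbol{R})|=\tfrac t2+\tfrac14\bigl(a_{T,\boldsymbol{R}}(0)-2a_{T,\boldsymbol{R}}(1)+a_{T,\boldsymbol{R}}(2)\bigr),$$ $$|\boldsymbol{Q}(T,\boldsymbol{R})|=\tfrac{3t}{4}+\tfrac14\bigl(-a_{T,\boldsymbol{R}}(1)+a_{T,\boldsymbol{R}}(2)\bigr),$$ where $a_{T,\boldsymbol{R}}$ is the autocorrelation of the distance vector of the cycle $\boldsymbol{R}$ with respect to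 the tope $T$.
   Context: Topes of an oriented matroid are written as vectors in $\{1,-1\}^t\subset\mathbb{R}^t$ (the signs $+,-$ are replaced by the real numbers $1,-1$). "Simple" means without loops, parallel or antiparallel elements. The tope graph has vertex set $\mathcal{T}$, two topes being adjacent iff they differ in exactly one component; the graph distance $d(T',T'')$ between topes equals the Hamming distance (number of components in which $T'$ and $T''$ differ). A symmetric cycle in the tope graph is a cycle $\boldsymbol{R}=(R^0,R^1,\ldots,R^{2t-1},R^0)$ of length $2t$ (with $2t$ distinct vertices) such that $R^{k+t}=-R^k$ for $0\le k\le t-1$. It is known that for every $T\in\mathcal{T}$ there is a unique inclusion-minimal subset $\boldsymbol{Q}(T,\boldsymbol{R})$ of $\{R^0,\ldots,R^{2t-1}\}$ whose elements sum (in $\mathbb{R}^t$) to $T$. The distance vector of $\boldsymbol{R}$ with respect to $T$ is $z_{T,\boldsymbol{R}}=(z_{T,\boldsymbol{R}}(0),\ldots,z_{T,\boldsymbol{R}}(2t-1))$ with $z_{T,\boldsymbol{R}}(k):=d(T,R^k)$. Its autocorrelation is defined by $$a_{T,\boldsymbol{R}}(m):=\sum_{n=0}^{2t-1}z_{T,\boldsymbol{R}}(n)\,z_{T,\boldsymbol{R}}\bigl((n+m)\bmod 2t\bigr),\qquad 0\le m\le 2t-1.$$ *)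

theory Defs
  imports "HOL-Analysis.Analysis"
begin

text \<open>
  The ground set is the finite index type \<open>'n\<close>, so that \<open>t = CARD('n)\<close>; sign vectors are
  vectors in \<open>real ^ 'n\<close> with components \<open>1, -1, 0\<close> for the signs \<open>+, -, 0\<close>. An oriented
  matroid is given by its set of covectors.
\<close>

definition sign_vector :: "real ^ 'n \<Rightarrow> bool" where
  "sign_vector X \<longleftrightarrow> (\<forall>e. X $ e \<in> {-1, 0, 1})"

definition composition :: "real ^ 'n \<Rightarrow> real ^ 'n \<Rightarrow> real ^ 'n" where
  "composition X Y = (\<chi> e. if X $ e \<noteq> 0 then X $ e else Y $ e)"

definition separation :: "real ^ 'n \<Rightarrow> real ^ 'n \<Rightarrow> 'n set" where
  "separation X Y = {e. X $ e \<noteq> 0 \<and> X $ e = - Y $ e}"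

definition oriented_matroid :: "(real ^ 'n) set \<Rightarrow> bool" where
  "oriented_matroid L \<longleftrightarrow>
     (\<forall>X\<in>L. sign_vector X) \<and>
     0 \<in> L \<and>
     (\<forall>X\<in>L. - X \<in> L) \<and>
     (\<forall>X\<in>L. \<forall>Y\<in>L. composition X Y \<in> L) \<and>
     (\<forall>X\<in>L. \<forall>Y\<in>L. \<forall>e\<in>separation X Y.
        \<exists>Z\<in>L. Z $ e = 0 \<and> (\<forall>f. f \<notin> separation X Y \<longrightarrow> Z $ f = composition X Y $ f))"

definition is_loop :: "(real ^ 'n) set \<Rightarrow> 'n \<Rightarrow> bool" where
  "is_loop L e \<longleftrightarrow> (\<forall>X\<in>L. X $ e = 0)"

definition parallel_elements :: "(real ^ 'n) set \<Rightarrow> 'n \<Rightarrow> 'n \<Rightarrow> bool" where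
  "parallel_elements L e f \<longleftrightarrow> (\<forall>X\<in>L. X $ e = X $ f)"

definition antiparallel_elements :: "(real ^ 'n) set \<Rightarrow> 'n \<Rightarrow> 'n \<Rightarrow> bool" where
  "antiparallel_elements L e f \<longleftrightarrow> (\<forall>X\<in>L. X $ e = - X $ f)"

definition simple_oriented_matroid :: "(real ^ 'n) set \<Rightarrow> bool" where
  "simple_oriented_matroid L \<longleftrightarrow>
     oriented_matroid L \<and>
     (\<forall>e. \<not> is_loop L e) \<and>
     (\<forall>e f. e \<noteq> f \<longrightarrow> \<not> parallel_elements L e f \<and> \<not> antiparallel_elements L e f)"

text \<open>The order on sign vectors is induced by \<open>0 < +\<close> and \<open>0 < -\<close>, with \<open>+\<close> and \<open>-\<close> incomparable.\<close>

definition sign_le :: "real ^ 'n \<Rightarrow> real ^ 'n \<Rightarrow> bool" where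
  "sign_le X Y \<longleftrightarrow> (\<forall>e. X $ e = 0 \<or> X $ e = Y $ e)"

definition topes :: "(real ^ 'n) set \<Rightarrow> (real ^ 'n) set" where
  "topes L = {X \<in> L. \<forall>Y\<in>L. sign_le X Y \<longrightarrow> Y = X}"

definition tope_adj :: "(real ^ 'n::finite) set \<Rightarrow> ((real ^ 'n) \<times> (real ^ 'n)) set" where
  "tope_adj L = {(X, Y). X \<in> topes L \<and> Y \<in> topes L \<and> card {e. X $ e \<noteq> Y $ e} = 1}"

text \<open>Graph distance: the least length of a walk. It is used only in connected tope graphs.\<close>

definition tope_dist :: "(real ^ 'n::finite) set \<Rightarrow> real ^ 'n \<Rightarrow> real ^ 'n \<Rightarrow> nat" where
  "tope_dist L X Y = (LEAST n. (X, Y) \<in> tope_adj L ^^ n)"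

text \<open>Only the values of \<open>R\<close> at the indices below \<open>2 * CARD('n)\<close> are relevant.\<close>

definition symmetric_cycle :: "(real ^ 'n::finite) set \<Rightarrow> (nat \<Rightarrow> real ^ 'n) \<Rightarrow> bool" where
  "symmetric_cycle L R \<longleftrightarrow>
     inj_on R {..<2 * CARD('n)} \<and>
     (\<forall>k<2 * CARD('n). R k \<in> topes L) \<and>
     (\<forall>k<2 * CARD('n). (R k, R ((k + 1) mod (2 * CARD('n)))) \<in> tope_adj L) \<and>
     (\<forall>k<CARD('n). R (k + CARD('n)) = - R k)"

definition cycle_vertices :: "(nat \<Rightarrow> real ^ 'n::finite) \<Rightarrow> (real ^ 'n) set" where
  "cycle_vertices R = R ` {..<2 * CARD('n)}"

definition minimal_decomposition ::
    "real ^ 'n \<Rightarrow> (nat \<Rightarrow> real ^ 'n::finite) \<Rightarrow> (real ^ 'n) set \<Rightarrow> bool" where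
  "minimal_decomposition T R Q \<longleftrightarrow>
     Q \<subseteq> cycle_vertices R \<and> \<Sum>Q = T \<and> (\<forall>Q'. Q' \<subset> Q \<longrightarrow> \<Sum>Q' \<noteq> T)"

text \<open>
  For a symmetric cycle \<open>R\<close> and a tope \<open>T\<close> there is exactly one minimal decomposition.
\<close>

definition decomposition_set ::
    "real ^ 'n \<Rightarrow> (nat \<Rightarrow> real ^ 'n::finite) \<Rightarrow> (real ^ 'n) set" where
  "decomposition_set T R = (THE Q. minimal_decomposition T R Q)"

definition distance_vector ::
    "(real ^ 'n::finite) set \<Rightarrow> real ^ 'n \<Rightarrow> (nat \<Rightarrow> real ^ 'n) \<Rightarrow> nat \<Rightarrow> nat" where
  "distance_vector L T R k = tope_dist L T (R k)"

definition autocorrelation ::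
    "(real ^ 'n::finite) set \<Rightarrow> real ^ 'n \<Rightarrow> (nat \<Rightarrow> real ^ 'n) \<Rightarrow> nat \<Rightarrow> real" where
  "autocorrelation L T R m =
     (\<Sum>n<2 * CARD('n). real (distance_vector L T R n) *
        real (distance_vector L T R ((n + m) mod (2 * CARD('n)))))"

end

theory Submission
  imports Defs
begin

text \<open>
  Along the cycle the distance \<open>z k\<close> to \<open>T\<close> changes by \<open>s k = \<plusminus>1\<close> at each step, and every
  component is flipped exactly once in each half of the cycle. Writing \<open>T\<close> as the sum of its
  components in the order in which they are flipped and summing by parts gives
  \<open>4 T = (\<Sum>k<2 * t. (s k - s (k - 1)) R\<^sup>k)\<close>. The coefficients are \<open>2\<close> at the local minima of \<open>z\<close>
  and \<open>-2\<close> at the local maxima, which are the antipodes of the minima; so \<open>T\<close> is the sum of the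
  vertices at the local minima. These form the minimal decomposition, because a half of the cycle
  is a basis and a minimal decomposition contains no antipodal pair.

  The number of local minima is therefore an eighth of the sum of \<open>(z (k + 1) - 2 z k + z (k - 1))\<^sup>2\<close>,
  while the \<open>(z (k + 1) - z k)\<^sup>2\<close> sum to \<open>2 t\<close>. Expanding both gives
  \<open>4 q = 3 a 0 - 4 a 1 + a 2\<close> and \<open>t = a 0 - a 1\<close>, from which all four formulas follow.
\<close>

section \<open>Hamming distance\<close>

definition hamming_dist :: "real ^ 'n \<Rightarrow> real ^ 'n::finite \<Rightarrow> nat" where
  "hamming_dist X Y = card {e. X $ e \<noteq> Y $ e}"

lemma hamming_dist_eq_0_iff [simp]: "hamming_dist X Y = 0 \<longleftrightarrow> X = Y"
  by (auto simp: hamming_dist_def vec_eq_iff)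

lemma hamming_dist_triangle: "hamming_dist X Z \<le> hamming_dist X Y + hamming_dist Y Z"
proof -
  have "{e. X $ e \<noteq> Z $ e} \<subseteq> {e. X $ e \<noteq> Y $ e} \<union> {e. Y $ e \<noteq> Z $ e}" by auto
  then have "hamming_dist X Z \<le> card ({e. X $ e \<noteq> Y $ e} \<union> {e. Y $ e \<noteq> Z $ e})"
    unfolding hamming_dist_def by (intro card_mono) auto
  also have "\<dots> \<le> hamming_dist X Y + hamming_dist Y Z"
    unfolding hamming_dist_def by (rule card_Un_le)
  finally show ?thesis .
qed

section \<open>Distances in the tope graph\<close>

text \<open>As \<open>e\<close> is not a loop, some covector is nonzero at \<open>e\<close>;
  composing \<open>X\<close> with it would give a strictly larger covector if \<open>X\<close>
  vanished there.\<close>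

lemma topes_nonzero:
  assumes "simple_oriented_matroid L" "X \<in> topes L"
  shows "X $ e \<noteq> 0"
proof
  assume zero: "X $ e = 0"
  obtain Y where Y: "Y \<in> L" "Y $ e \<noteq> 0"
    using assms(1) unfolding simple_oriented_matroid_def is_loop_def by blast
  have X: "X \<in> L" "\<And>Y. Y \<in> L \<Longrightarrow> sign_le X Y \<Longrightarrow> Y = X"
    using assms(2) unfolding topes_def by auto
  have "composition X Y \<in> L"
    using assms(1) X Y unfolding simple_oriented_matroid_def oriented_matroid_def by blast
  moreover have "sign_le X (composition X Y)"
    by (auto simp: sign_le_def composition_def)
  ultimately have "composition X Y = X" using X by blast
  then have "composition X Y $ e = X $ e" by simp
  with zero Y show False by (simp add: composition_def)
qed

lemma topes_iff:
  assumes "simple_oriented_matroid L"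
  shows "X \<in> topes L \<longleftrightarrow> X \<in> L \<and> (\<forall>e. X $ e \<noteq> 0)"
proof
  assume "X \<in> topes L"
  then show "X \<in> L \<and> (\<forall>e. X $ e \<noteq> 0)"
    using topes_nonzero[OF assms] unfolding topes_def by blast
next
  assume "X \<in> L \<and> (\<forall>e. X $ e \<noteq> 0)"
  then show "X \<in> topes L"
    unfolding topes_def sign_le_def vec_eq_iff by simp
qed

lemma topes_sign:
  assumes "simple_oriented_matroid L" "X \<in> topes L"
  shows "X $ e = 1 \<or> X $ e = -1"
proof -
  have "sign_vector X"
    using assms unfolding simple_oriented_matroid_def oriented_matroid_def topes_def by auto
  then show ?thesis using topes_nonzero[OF assms, of e] unfolding sign_vector_def by auto
qed

text \<open>
  Among the topes \<open>Z \<noteq> X\<close> differing from \<open>X\<close> only where \<open>Y\<close> does, take one with the fewest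
  differences. If it had two, eliminating one of them between \<open>X\<close> and \<open>Z\<close> gives, by minimality, a
  covector \<open>W\<close> vanishing exactly on the differences; a covector telling two of them apart then
  refines \<open>W\<close> to a tope closer to \<open>X\<close>.
\<close>

lemma tope_neighbour_towards:
  fixes L :: "(real ^ 'n::finite) set"
  assumes L: "simple_oriented_matroid L" and X: "X \<in> topes L" and Y: "Y \<in> topes L" and "X \<noteq> Y"
  obtains Z where "Z \<in> topes L" "hamming_dist X Z = 1"
    "{e. X $ e \<noteq> Z $ e} \<subseteq> {e. X $ e \<noteq> Y $ e}"
proof -
  define ok where "ok Z \<longleftrightarrow> Z \<in> topes L \<and> Z \<noteq> X \<and> {e. X $ e \<noteq> Z $ e} \<subseteq> {e. X $ e \<noteq> Y $ e}" for Z
  have "ok Y" using Y \<open>X \<noteq> Y\<close> by (auto simp: ok_def)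
  then obtain Z where Z: "ok Z" and least: "\<And>Z'. ok Z' \<Longrightarrow> hamming_dist X Z \<le> hamming_dist X Z'"
    using ex_has_least_nat[of ok Y "hamming_dist X"] by blast
  let ?S = "{e. X $ e \<noteq> Z $ e}"
  have no_smaller: "Z' = X" if "Z' \<in> topes L" "{e. X $ e \<noteq> Z' $ e} \<subset> ?S" for Z'
  proof (rule ccontr)
    assume "Z' \<noteq> X"
    with that Z have "ok Z'" by (auto simp: ok_def)
    then have "card ?S \<le> card {e. X $ e \<noteq> Z' $ e}" using least unfolding hamming_dist_def by blast
    moreover have "card {e. X $ e \<noteq> Z' $ e} < card ?S" using that(2) by (intro psubset_card_mono) auto
    ultimately show False by simp
  qed
  have om: "oriented_matroid L" using L by (simp add: simple_oriented_matroid_def)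
  have comp: "composition A B \<in> L" if "A \<in> L" "B \<in> L" for A B
    using om that unfolding oriented_matroid_def by blast
  have neg: "- A \<in> L" if "A \<in> L" for A
    using om that unfolding oriented_matroid_def by blast
  have sgn: "A $ e = 0 \<or> A $ e = 1 \<or> A $ e = -1" if "A \<in> L" for A e
    using om that unfolding oriented_matroid_def sign_vector_def by auto
  have Zt: "Z \<in> topes L" and ZX: "Z \<noteq> X" using Z by (auto simp: ok_def)
  have XL: "X \<in> L" and ZL: "Z \<in> L" using X Zt by (auto simp: topes_def)
  note Xs = topes_sign[OF L X] and Zs = topes_sign[OF L Zt]
  have Xnz: "X $ g \<noteq> 0" for g using topes_nonzero[OF L X] .
  have "X $ g = - Z $ g \<longleftrightarrow> X $ g \<noteq> Z $ g" for g using Xs[of g] Zs[of g] by auto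
  then have sep: "separation X Z = ?S" by (simp add: separation_def Xnz)
  have "hamming_dist X Z = 1"
  proof (rule ccontr)
    assume ne: "hamming_dist X Z \<noteq> 1"
    obtain e where e: "e \<in> ?S" using ZX unfolding vec_eq_iff by fastforce
    have "?S \<noteq> {e}" using ne unfolding hamming_dist_def by force
    with e obtain f where f: "f \<in> ?S" "f \<noteq> e" by blast
    obtain W where W: "W \<in> L" "W $ e = 0" "\<And>g. g \<notin> ?S \<Longrightarrow> W $ g = composition X Z $ g"
      using om XL ZL e unfolding oriented_matroid_def sep[symmetric] by blast
    have Wout: "W $ g = X $ g" if "g \<notin> ?S" for g
      using W(3)[OF that] topes_nonzero[OF L X] by (simp add: composition_def)
    have full: "composition W A \<in> topes L" if "A \<in> topes L" for A
      using that W(1) comp[of W A] by (auto simp: topes_iff[OF L] composition_def)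
    \<comment> \<open>This composite keeps the value of \<open>X\<close> at \<open>e\<close>, so by
      minimality it is \<open>X\<close>: wherever \<open>W\<close> is nonzero, it agrees with
      \<open>X\<close>.\<close>
    have "{g. X $ g \<noteq> composition W X $ g} \<subset> ?S"
    proof
      show "{g. X $ g \<noteq> composition W X $ g} \<subseteq> ?S" using Wout by (auto simp: composition_def)
      have "composition W X $ e = X $ e" using W(2) by (simp add: composition_def)
      then show "{g. X $ g \<noteq> composition W X $ g} \<noteq> ?S" using e by (metis (lifting) mem_Collect_eq)
    qed
    then have WX: "composition W X = X" using no_smaller full X by blast
    have "W $ g = 0" if "g \<in> ?S" for g
    proof (rule ccontr)
      assume nz: "W $ g \<noteq> 0"
      have "X $ g = W $ g" using arg_cong[OF WX, of "\<lambda>A. A $ g"] nz by (simp add: composition_def)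
      \<comment> \<open>A nonzero \<open>W $ g\<close> makes this composite agree with
        \<open>X\<close> at \<open>g\<close>, so minimality forces it to be \<open>X\<close>; yet at
        \<open>e\<close> it has the value of \<open>Z\<close>.\<close>
      have "{h. X $ h \<noteq> composition W Z $ h} \<subset> ?S"
      proof
        show "{h. X $ h \<noteq> composition W Z $ h} \<subseteq> ?S" using Wout by (auto simp: composition_def)
        have "composition W Z $ g = X $ g"
          using nz \<open>X $ g = W $ g\<close> by (simp add: composition_def)
        then show "{h. X $ h \<noteq> composition W Z $ h} \<noteq> ?S" using that by (metis (lifting) mem_Collect_eq)
      qed
      then have "composition W Z = X" using no_smaller full Zt by blast
      then have "composition W Z $ e = X $ e" by simp
      with e W(2) show False by (simp add: composition_def)
    qed
    note Win = this
    \<comment> \<open>The factors \<open>X $ e\<close> and \<open>X $ f\<close> measure the signs of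
      \<open>V\<close> relative to \<open>X\<close>. If \<open>X\<close> has equal signs at
      \<open>e\<close> and \<open>f\<close>, such a \<open>V\<close> exists because they are not
      parallel, otherwise because they are not antiparallel.\<close>
    obtain V where V: "V \<in> L" "V $ e * X $ e \<noteq> V $ f * X $ f"
    proof (cases "X $ e = X $ f")
      case True
      obtain V where "V \<in> L" "V $ e \<noteq> V $ f"
        using L f unfolding simple_oriented_matroid_def parallel_elements_def by metis
      then show ?thesis using True that Xnz by simp
    next
      case False
      then have opp: "X $ e = - X $ f" using Xs[of e] Xs[of f] by auto
      obtain V where V: "V \<in> L" "V $ e \<noteq> - V $ f"
        using L f unfolding simple_oriented_matroid_def antiparallel_elements_def by metis
      have "V $ e * X $ e - V $ f * X $ f = - ((V $ e + V $ f) * X $ f)"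
        unfolding opp by (simp add: distrib_right)
      moreover have "(V $ e + V $ f) * X $ f \<noteq> 0"
        using V(2) Xnz[of f] by (simp add: eq_neg_iff_add_eq_0)
      ultimately show ?thesis using that[OF V(1)] by fastforce
    qed
    \<comment> \<open>Relative to \<open>X\<close>, the signs of \<open>V\<close> at
      \<open>e\<close> and \<open>f\<close> are distinct elements of -1, 0, 1. After negating
      \<open>V\<close> if neither is -1, exactly one of them is -1, and its element is taken as
      \<open>a\<close>.\<close>
    obtain U a b where U: "U \<in> L" "U $ a = - X $ a" "U $ b \<noteq> - X $ b" "a \<in> ?S" "b \<in> ?S"
    proof -
      have "(V $ e = - X $ e \<and> V $ f \<noteq> - X $ f) \<or> (V $ f = - X $ f \<and> V $ e \<noteq> - X $ e) \<or>
        (- V $ e = - X $ e \<and> - V $ f \<noteq> - X $ f) \<or> (- V $ f = - X $ f \<and> - V $ e \<noteq> - X $ e)"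
        using V(2) sgn[OF V(1), of e] sgn[OF V(1), of f] Xs[of e] Xs[of f] by auto
      then show ?thesis
        using that[of V e f] that[of V f e] that[of "- V" e f] that[of "- V" f e] V(1) neg[OF V(1)] e f
        by auto
    qed
    \<comment> \<open>\<open>W\<close> fixes the components outside \<open>?S\<close>,
      \<open>U\<close> acts inside it, and \<open>X\<close> fills the remaining zeros. The result
      differs from \<open>X\<close> at \<open>a\<close> but not at \<open>b\<close>.\<close>
    let ?Z = "composition W (composition U X)"
    have "?Z \<in> topes L"
      using comp[OF W(1) comp[OF U(1) XL]] topes_nonzero[OF L X]
      by (auto simp: topes_iff[OF L] composition_def)
    moreover have Za: "?Z $ a = - X $ a" and Zb: "?Z $ b = X $ b"
      using U Win sgn[OF U(1), of b] Xs[of b] topes_nonzero[OF L X] by (auto simp: composition_def)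
    have "{g. X $ g \<noteq> ?Z $ g} \<subset> ?S"
    proof
      show "{g. X $ g \<noteq> ?Z $ g} \<subseteq> ?S" using Wout Xnz by (auto simp: composition_def)
      show "{g. X $ g \<noteq> ?Z $ g} \<noteq> ?S" using Zb U(5) by (metis (lifting) mem_Collect_eq)
    qed
    ultimately have "?Z = X" using no_smaller by blast
    then show False using Za topes_nonzero[OF L X, of a] by simp
  qed
  with Z that show thesis by (auto simp: ok_def)
qed

lemma hamming_dist_le_relpow:
  "(X, Y) \<in> tope_adj L ^^ n \<Longrightarrow> hamming_dist X Y \<le> n"
proof (induction n arbitrary: Y)
  case (Suc n)
  then obtain Z where Z: "(X, Z) \<in> tope_adj L ^^ n" "(Z, Y) \<in> tope_adj L" by auto
  then have "hamming_dist Z Y = 1" by (auto simp: tope_adj_def hamming_dist_def)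
  with Suc.IH[OF Z(1)] hamming_dist_triangle[of X Y Z] show ?case by simp
qed simp

text \<open>A step to a neighbour towards \<open>Y\<close> flips one component where
  \<open>X\<close> and \<open>Y\<close> differ. With only two signs available, that component then
  agrees with \<open>Y\<close>, so the Hamming distance drops by one.\<close>

lemma relpow_hamming_dist:
  assumes L: "simple_oriented_matroid L"
  shows "X \<in> topes L \<Longrightarrow> Y \<in> topes L \<Longrightarrow> (X, Y) \<in> tope_adj L ^^ hamming_dist X Y"
proof (induction "hamming_dist X Y" arbitrary: X)
  case 0
  then have "X = Y" using hamming_dist_eq_0_iff[of X Y] by simp
  then show ?case unfolding 0(1)[symmetric] by simp
next
  case (Suc n)
  have "X \<noteq> Y" using Suc.hyps(2) hamming_dist_eq_0_iff[of X Y] by linarith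
  from tope_neighbour_towards[OF L Suc.prems this] obtain Z
    where Z: "Z \<in> topes L" "hamming_dist X Z = 1" "{e. X $ e \<noteq> Z $ e} \<subseteq> {e. X $ e \<noteq> Y $ e}" .
  have "Z $ e \<noteq> Y $ e \<longleftrightarrow> X $ e \<noteq> Y $ e \<and> X $ e = Z $ e" for e
    using subsetD[OF Z(3), of e] topes_sign[OF L Z(1), of e]
      topes_sign[OF L Suc.prems(1), of e] topes_sign[OF L Suc.prems(2), of e]
    by auto
  then have "{e. Z $ e \<noteq> Y $ e} = {e. X $ e \<noteq> Y $ e} - {e. X $ e \<noteq> Z $ e}" by blast
  then have "hamming_dist Z Y = hamming_dist X Y - hamming_dist X Z"
    unfolding hamming_dist_def using Z(3) by (simp add: card_Diff_subset)
  then have n: "n = hamming_dist Z Y" using Z(2) Suc.hyps(2) by simp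
  have "(X, Z) \<in> tope_adj L" using Suc.prems Z by (simp add: tope_adj_def hamming_dist_def)
  then have "(X, Y) \<in> tope_adj L ^^ Suc n"
    using Suc.hyps(1)[OF n Z(1) Suc.prems(2)] unfolding n[symmetric] by (rule relpow_Suc_I2)
  then show ?case unfolding Suc.hyps(2) .
qed

lemma tope_dist_eq_hamming_dist:
  assumes "simple_oriented_matroid L" "X \<in> topes L" "Y \<in> topes L"
  shows "tope_dist L X Y = hamming_dist X Y"
  unfolding tope_dist_def
  by (rule Least_equality) (rule relpow_hamming_dist[OF assms], rule hamming_dist_le_relpow)

section \<open>Antipode-free subsets of a symmetrised basis\<close>

lemma sum_signed_subset:
  fixes B :: "'a::real_vector set"
  assumes "independent B" "finite B" "Q \<subseteq> B \<union> uminus ` B"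
  shows "\<Sum>Q = (\<Sum>b\<in>B. (of_bool (b \<in> Q) - of_bool (- b \<in> Q)) *\<^sub>R b)"
proof -
  have disj: "- b \<notin> B" if "b \<in> B" for b
  proof
    assume "- b \<in> B"
    have "b \<noteq> 0" using that assms(1) dependent_zero by blast
    then have "- b \<noteq> b" by (metis add_eq_0_iff scaleR_2 scaleR_eq_0_iff zero_neq_numeral)
    then have "b \<in> span (B - {b})" using \<open>- b \<in> B\<close>
      by (metis DiffI add.inverse_inverse empty_iff insertE span_base span_neg)
    with that assms(1) show False by (auto simp: dependent_def)
  qed
  have Q: "Q = {b \<in> B. b \<in> Q} \<union> uminus ` {b \<in> B. - b \<in> Q}" using assms(3) by auto
  have "\<Sum>Q = \<Sum>{b \<in> B. b \<in> Q} + \<Sum>(uminus ` {b \<in> B. - b \<in> Q})"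
    by (subst Q, rule sum.union_disjoint) (use assms(2) disj in auto)
  also have "\<Sum>(uminus ` {b \<in> B. - b \<in> Q}) = (\<Sum>b\<in>{b \<in> B. - b \<in> Q}. - b)"
    by (subst sum.reindex) (auto simp: inj_on_def)
  also have "\<Sum>{b \<in> B. b \<in> Q} + \<dots>
      = (\<Sum>b\<in>B. if b \<in> Q then b else 0) + (\<Sum>b\<in>B. if - b \<in> Q then - b else 0)"
    using assms(2) by (simp only: sum.inter_filter)
  also have "\<dots> = (\<Sum>b\<in>B. (of_bool (b \<in> Q) - of_bool (- b \<in> Q)) *\<^sub>R b)"
    unfolding sum.distrib[symmetric] by (rule sum.cong) auto
  finally show ?thesis .
qed

text \<open>Equal sums have equal coordinates over \<open>B\<close>. Without antipodal pairs, the
  coordinates 1, -1 and 0 tell whether \<open>b\<close>, \<open>- b\<close> or neither belongs to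
  the set.\<close>

lemma antipode_free_sum_inject:
  fixes B :: "'a::real_vector set"
  assumes B: "independent B" "finite B"
    and Q: "Q \<subseteq> B \<union> uminus ` B" "\<And>v. v \<in> Q \<Longrightarrow> - v \<notin> Q"
    and M: "M \<subseteq> B \<union> uminus ` B" "\<And>v. v \<in> M \<Longrightarrow> - v \<notin> M"
    and eq: "\<Sum>Q = \<Sum>M"
  shows "Q = M"
proof -
  define c where "c A b = (of_bool (b \<in> A) - of_bool (- b \<in> A) :: real)" for A and b :: 'a
  have "(\<Sum>b\<in>B. (c Q b - c M b) *\<^sub>R b) = 0"
    using eq sum_signed_subset[OF B Q(1)] sum_signed_subset[OF B M(1)]
    by (simp add: c_def scaleR_diff_left sum_subtractf)
  then have "c Q b - c M b = 0" if "b \<in> B" for b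
    using independentD[OF B order.refl, of "\<lambda>b. c Q b - c M b" b] that by simp
  then have *: "c Q b = c M b" if "b \<in> B" for b
    using that by simp
  have "(b \<in> Q \<longleftrightarrow> b \<in> M) \<and> (- b \<in> Q \<longleftrightarrow> - b \<in> M)" if "b \<in> B" for b
    using *[OF that] Q(2)[of b] M(2)[of b] by (auto simp: c_def of_bool_def split: if_splits)
  then show ?thesis using Q(1) M(1) by blast
qed

section \<open>Sums over a period\<close>

lemma periodic_mod:
  fixes f :: "nat \<Rightarrow> 'a"
  assumes "\<And>k. f (k + N) = f k"
  shows "f (k mod N) = f k"
proof -
  have "f (i + j * N) = f i" for i j
  proof (induction j)
    case (Suc j)
    have "i + Suc j * N = (i + j * N) + N" by simp
    also have "f \<dots> = f i" by (simp only: assms Suc.IH)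
    finally show ?case .
  qed simp
  from this[of "k mod N" "k div N"] show ?thesis by simp
qed

lemma sum_periodic_shift:
  fixes f :: "nat \<Rightarrow> 'a::ab_group_add"
  assumes "\<And>k. f (k + N) = f k"
  shows "(\<Sum>k<N. f (k + m)) = (\<Sum>k<N. f k)"
proof (induction m)
  case (Suc m)
  have "(\<Sum>k<Suc N. f (k + m)) = f m + (\<Sum>k<N. f (k + Suc m))"
    by (subst sum.lessThan_Suc_shift) simp
  moreover have "(\<Sum>k<Suc N. f (k + m)) = (\<Sum>k<N. f (k + m)) + f m"
    using assms[of m] by (simp add: add.commute)
  ultimately have "(\<Sum>k<N. f (k + Suc m)) = (\<Sum>k<N. f (k + m))"
    by (simp add: add.commute)
  with Suc.IH show ?case by simp
qed simp

lemma sum_lessThan_add: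
  fixes f :: "nat \<Rightarrow> 'a::comm_monoid_add"
  shows "(\<Sum>k<m + n. f k) = (\<Sum>k<m. f k) + (\<Sum>k<n. f (k + m))"
  by (induction n) (simp_all add: add.assoc add.commute[of m])

text \<open>Periodicity makes the sum of a product depend only on the lag between its two factors.
  The second differences below are treated in the same way, with lags up to 2.\<close>

lemma sum_first_difference_squared:
  fixes z :: "nat \<Rightarrow> real"
  assumes "\<And>k. z (k + N) = z k"
  shows "(\<Sum>k<N. (z (k + 1) - z k)\<^sup>2) = 2 * (\<Sum>k<N. z k * z k) - 2 * (\<Sum>k<N. z k * z (k + 1))"
proof -
  have "(\<Sum>k<N. (z (k + 1) - z k)\<^sup>2)
      = (\<Sum>k<N. z (k + 1) * z (k + 1)) + (\<Sum>k<N. z k * z k) - 2 * (\<Sum>k<N. z k * z (k + 1))"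
    by (simp add: sum_distrib_left flip: sum.distrib sum_subtractf)
      (simp add: power2_eq_square algebra_simps)
  also have "(\<Sum>k<N. z (k + 1) * z (k + 1)) = (\<Sum>k<N. z k * z k)"
    by (rule sum_periodic_shift[of "\<lambda>k. z k * z k"]) (simp add: assms)
  finally show ?thesis by simp
qed

lemma sum_second_difference_squared:
  fixes z :: "nat \<Rightarrow> real"
  assumes "\<And>k. z (k + N) = z k"
  shows "(\<Sum>k<N. (z (k + 2) - 2 * z (k + 1) + z k)\<^sup>2)
    = 6 * (\<Sum>k<N. z k * z k) - 8 * (\<Sum>k<N. z k * z (k + 1)) + 2 * (\<Sum>k<N. z k * z (k + 2))"
proof -
  have per: "z (k + N + m) = z (k + m)" for k m
    using assms[of "k + m"] by (simp add: ac_simps)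
  have "(\<Sum>k<N. (z (k + 2) - 2 * z (k + 1) + z k)\<^sup>2)
      = (\<Sum>k<N. z (k + 2) * z (k + 2)) + 4 * (\<Sum>k<N. z (k + 1) * z (k + 1)) + (\<Sum>k<N. z k * z k)
        - 4 * (\<Sum>k<N. z (k + 1) * z (k + 2)) - 4 * (\<Sum>k<N. z k * z (k + 1))
        + 2 * (\<Sum>k<N. z k * z (k + 2))"
    unfolding sum_distrib_left sum.distrib[symmetric] sum_subtractf[symmetric]
    by (rule sum.cong) (simp_all add: power2_eq_square algebra_simps)
  moreover have "(\<Sum>k<N. z (k + 1) * z (k + 1)) = (\<Sum>k<N. z k * z k)"
    "(\<Sum>k<N. z (k + 2) * z (k + 2)) = (\<Sum>k<N. z k * z k)"
    by (rule sum_periodic_shift[of "\<lambda>k. z k * z k"]; simp add: assms)+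
  moreover have "(\<Sum>k<N. z (k + 1) * z (k + 2)) = (\<Sum>k<N. z k * z (k + 1))"
    using sum_periodic_shift[of "\<lambda>k. z k * z (k + 1)" N 1] per[of _ 1]
    by (simp add: assms add.assoc)
  ultimately show ?thesis by simp
qed

section \<open>Antipodal cycles of sign vectors\<close>

text \<open>A component contributes \<open>(1 - X $ e * Y $ e) / 2\<close>, which is 0 on agreement
  and 1 on disagreement. The distance thus becomes affine in \<open>Y\<close>, and its change along
  a step is linear in the step.\<close>

lemma hamming_dist_inner:
  fixes X Y :: "real ^ 'n::finite"
  assumes "\<And>e. X $ e = 1 \<or> X $ e = -1" "\<And>e. Y $ e = 1 \<or> Y $ e = -1"
  shows "real (hamming_dist X Y) = (real CARD('n) - X \<bullet> Y) / 2"
proof -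
  have "real (hamming_dist X Y) = (\<Sum>e\<in>UNIV. of_bool (X $ e \<noteq> Y $ e))"
    unfolding hamming_dist_def by (simp add: of_bool_def sum.If_cases)
  also have "\<dots> = (\<Sum>e\<in>UNIV. (1 - X $ e * Y $ e) / 2)"
  proof (rule sum.cong)
    show "of_bool (X $ e \<noteq> Y $ e) = (1 - X $ e * Y $ e) / 2" for e
      using assms(1)[of e] assms(2)[of e] by auto
  qed simp
  also have "\<dots> = (real CARD('n) - X \<bullet> Y) / 2"
    by (simp add: inner_vec_def sum_subtractf flip: sum_divide_distrib)
  finally show ?thesis .
qed

text \<open>The cycle is unrolled to all natural indices, so that successors and antipodes are plain
  additions. Period \<open>2 * CARD('n)\<close> follows by applying \<open>antipode\<close>
  twice.\<close>

locale antipodal_cycle =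
  fixes P :: "nat \<Rightarrow> real ^ 'n::finite"
  assumes sign: "P k $ e = 1 \<or> P k $ e = -1"
    and step: "hamming_dist (P k) (P (Suc k)) = 1"
    and antipode: "P (k + CARD('n)) = - P k"
    and inj: "inj_on P {..<2 * CARD('n)}"
begin

definition flip :: "nat \<Rightarrow> 'n" where
  "flip k = (THE e. P k $ e \<noteq> P (Suc k) $ e)"

lemma flip_iff: "P k $ e \<noteq> P (Suc k) $ e \<longleftrightarrow> e = flip k"
proof -
  obtain d where d: "{e. P k $ e \<noteq> P (Suc k) $ e} = {d}"
    using step[of k] unfolding hamming_dist_def by (rule card_1_singletonE)
  then have *: "P k $ e \<noteq> P (Suc k) $ e \<longleftrightarrow> e = d" for e by blast
  then have "flip k = d" unfolding flip_def by simp
  with * show ?thesis by simp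
qed

lemma step_eq_axis: "P k - P (Suc k) = (2 * P k $ flip k) *\<^sub>R axis (flip k) 1"
proof (rule vec_eq_iff[THEN iffD2], rule allI)
  fix e
  show "(P k - P (Suc k)) $ e = ((2 * P k $ flip k) *\<^sub>R axis (flip k) 1) $ e"
    using flip_iff[of k e] sign[of k e] sign[of "Suc k" e] by (auto simp: axis_def)
qed

lemma periodic: "P (k + 2 * CARD('n)) = P k"
  using antipode[of k] antipode[of "k + CARD('n)"] by (simp add: mult_2 add.assoc)

lemma eq_iff: "P i = P j \<longleftrightarrow> i mod (2 * CARD('n)) = j mod (2 * CARD('n))"
proof -
  have "P i = P j \<longleftrightarrow> P (i mod (2 * CARD('n))) = P (j mod (2 * CARD('n)))"
    by (simp add: periodic_mod[of P, OF periodic])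
  also have "\<dots> \<longleftrightarrow> i mod (2 * CARD('n)) = j mod (2 * CARD('n))"
    by (rule inj_on_eq_iff[OF inj]) auto
  finally show ?thesis .
qed

lemma flip_antipode: "flip (k + CARD('n)) = flip k"
  using flip_iff[of "k + CARD('n)" "flip k"] flip_iff[of k "flip k"] antipode[of k] antipode[of "Suc k"]
  by simp

text \<open>A component not flipped in the first half would have the same sign in \<open>P 0\<close>
  and in its antipode. Hence all components are flipped, and equal cardinalities give
  injectivity.\<close>

lemma bij_betw_flip: "bij_betw flip {..<CARD('n)} UNIV"
proof -
  have surj: "flip ` {..<CARD('n)} = UNIV"
  proof (rule ccontr)
    assume "flip ` {..<CARD('n)} \<noteq> UNIV"
    then obtain e where e: "e \<notin> flip ` {..<CARD('n)}" by blast
    have "k \<le> CARD('n) \<Longrightarrow> P k $ e = P 0 $ e" for k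
    proof (induction k)
      case (Suc k)
      then have "e \<noteq> flip k" using e by auto
      with Suc flip_iff[of k e] show ?case by simp
    qed simp
    from this[of "CARD('n)"] show False using antipode[of 0] sign[of 0 e] by auto
  qed
  moreover have "inj_on flip {..<CARD('n)}"
    by (rule eq_card_imp_inj_on) (simp_all add: surj)
  ultimately show ?thesis by (simp add: bij_betw_def)
qed

text \<open>At most \<open>CARD('n)\<close> vectors that span the whole space are independent. They
  span because the steps of the half cycle are nonzero multiples of all the axis vectors.\<close>

lemma independent_half: "independent (P ` {..<CARD('n)})"
proof (rule card_le_dim_spanning[of _ UNIV])
  let ?S = "span (P ` {..<CARD('n)})"
  \<comment> \<open>The end point \<open>k = CARD('n)\<close> is included because the last step of
    the half cycle leads there; it is the antipode of \<open>P 0\<close>.\<close>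
  have P: "P k \<in> ?S" if "k \<le> CARD('n)" for k
  proof (cases "k = CARD('n)")
    case True
    then have "P k = - P 0" using antipode[of 0] by simp
    moreover have "P 0 \<in> ?S" by (rule span_base) simp
    ultimately show ?thesis by (simp add: span_neg)
  next
    case False
    with that show ?thesis by (intro span_base) simp
  qed
  have axis: "axis e 1 \<in> ?S" for e
  proof -
    obtain k where k: "k < CARD('n)" "e = flip k"
      using bij_betw_imp_surj_on[OF bij_betw_flip] by blast
    have "axis e 1 = (1 / (2 * P k $ e)) *\<^sub>R (P k - P (Suc k))"
      using sign[of k e] k(2) by (auto simp: step_eq_axis)
    also have "\<dots> \<in> ?S"
      using P[of k] P[of "Suc k"] k(1) by (intro span_mul span_diff) auto
    finally show ?thesis .
  qed
  have "x \<in> ?S" for x :: "real ^ 'n"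
  proof -
    have "(\<Sum>e\<in>UNIV. (x $ e) *\<^sub>R axis e 1) \<in> ?S" by (intro span_sum span_mul axis)
    then show ?thesis using basis_expansion[of x] by (simp add: scalar_mult_eq_scaleR)
  qed
  then show "UNIV \<subseteq> ?S" by blast
  show "card (P ` {..<CARD('n)}) \<le> dim (UNIV :: (real ^ 'n) set)"
    using card_image_le[of "{..<CARD('n)}" P] by simp
qed auto

lemma vertices_eq: "P ` {..<2 * CARD('n)} = P ` {..<CARD('n)} \<union> uminus ` P ` {..<CARD('n)}"
proof -
  have "{..<2 * CARD('n)} = {..<CARD('n)} \<union> (\<lambda>k. k + CARD('n)) ` {..<CARD('n)}"
  proof (intro equalityI subsetI)
    fix k assume "k \<in> {..<2 * CARD('n)}"
    then show "k \<in> {..<CARD('n)} \<union> (\<lambda>k. k + CARD('n)) ` {..<CARD('n)}"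
      by (cases "k < CARD('n)") (auto intro!: image_eqI[of _ _ "k - CARD('n)"])
  qed auto
  then show ?thesis by (simp add: image_Un image_image antipode)
qed

end

section \<open>Local minima of the distance to a fixed sign vector\<close>

locale antipodal_cycle_tope = antipodal_cycle P for P :: "nat \<Rightarrow> real ^ 'n::finite" +
  fixes T :: "real ^ 'n"
  assumes T_sign: "T $ e = 1 \<or> T $ e = -1"
begin

text \<open>The change of the distance to \<open>T\<close> in step \<open>k\<close>, see
  \<open>hamming_dist_diff\<close>: flipping a component that agrees with \<open>T\<close> moves
  away from \<open>T\<close>, flipping any other moves closer.\<close>

definition slope :: "nat \<Rightarrow> real" where
  "slope k = T $ flip k * P k $ flip k"

definition valley :: "nat \<Rightarrow> bool" where
  "valley k \<longleftrightarrow> slope k = -1 \<and> slope (Suc k) = 1"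

text \<open>The index of a valley is shifted by one, so that no predecessor of \<open>0\<close> is needed.\<close>

definition valleys :: "(real ^ 'n) set" where
  "valleys = (\<lambda>k. P (Suc k)) ` {k. k < 2 * CARD('n) \<and> valley k}"

lemma slope_cases: "slope k = 1 \<or> slope k = -1"
  using sign[of k "flip k"] T_sign[of "flip k"] by (auto simp: slope_def)

lemma hamming_dist_diff:
  "real (hamming_dist T (P (Suc k))) - real (hamming_dist T (P k)) = slope k"
proof -
  have "real (hamming_dist T (P (Suc k))) - real (hamming_dist T (P k))
      = T \<bullet> (P k - P (Suc k)) / 2"
    using T_sign sign by (simp add: hamming_dist_inner inner_diff_right field_simps)
  also have "\<dots> = slope k"
    by (simp add: step_eq_axis inner_axis slope_def)
  finally show ?thesis .
qed

lemma slope_antipode: "slope (k + CARD('n)) = - slope k"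
  by (simp add: slope_def flip_antipode antipode)

lemma slope_periodic: "slope (k + 2 * CARD('n)) = slope k"
  using slope_antipode[of k] slope_antipode[of "k + CARD('n)"] by (simp add: mult_2 add.assoc)

lemma valley_periodic: "valley (k + 2 * CARD('n)) = valley k"
  using slope_periodic[of k] slope_periodic[of "Suc k"] by (simp add: valley_def)

lemma not_valley_antipode: "valley k \<Longrightarrow> \<not> valley (k + CARD('n))"
  using slope_antipode[of k] by (simp add: valley_def)

text \<open>The slope jumps by 2 at a local minimum and by -2 at a local maximum. Since slopes
  change sign under the antipode, the maxima are the antipodes of the minima.\<close>

lemma slope_diff: "slope (Suc k) - slope k = 2 * of_bool (valley k) - 2 * of_bool (valley (k + CARD('n)))"
  using slope_cases[of k] slope_cases[of "Suc k"] slope_antipode[of k] slope_antipode[of "Suc k"]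
  by (auto simp: valley_def)

text \<open>The sign of \<open>P k\<close> at the flipped component occurs twice and squares to 1,
  leaving \<open>2 * T $ flip k\<close> on that axis; every axis occurs once.\<close>

lemma half_cycle_expansion: "2 *\<^sub>R T = (\<Sum>k<CARD('n). slope k *\<^sub>R (P k - P (Suc k)))"
proof -
  have "slope k *\<^sub>R (P k - P (Suc k)) = (2 * T $ flip k) *\<^sub>R axis (flip k) 1" for k
    using sign[of k "flip k"] by (auto simp: step_eq_axis slope_def)
  then have "(\<Sum>k<CARD('n). slope k *\<^sub>R (P k - P (Suc k)))
      = (\<Sum>k<CARD('n). (2 * T $ flip k) *\<^sub>R axis (flip k) 1)" by simp
  also have "\<dots> = (\<Sum>e\<in>UNIV. (2 * T $ e) *\<^sub>R axis e 1)"
    by (rule sum.reindex_bij_betw[OF bij_betw_flip])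
  also have "\<dots> = 2 *\<^sub>R (\<Sum>e\<in>UNIV. (T $ e) *\<^sub>R axis e 1)"
    by (simp add: scaleR_sum_right)
  also have "(\<Sum>e\<in>UNIV. (T $ e) *\<^sub>R axis e 1) = T"
    using basis_expansion[of T] by (simp add: scalar_mult_eq_scaleR)
  finally show ?thesis by simp
qed

lemma sum_valley_eq: "(\<Sum>k<2 * CARD('n). of_bool (valley k) *\<^sub>R P (Suc k)) = T"
proof -
  let ?N = "2 * CARD('n)"
  let ?V = "\<Sum>k<?N. of_bool (valley k) *\<^sub>R P (Suc k)"
  \<comment> \<open>In the second half both the slopes and the vertices change sign, so it
    contributes another \<open>2 *\<^sub>R T\<close>.\<close>
  have "4 *\<^sub>R T = 2 *\<^sub>R T + 2 *\<^sub>R T" by (simp flip: scaleR_left_distrib)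
  also have "\<dots> = (\<Sum>k<CARD('n) + CARD('n). slope k *\<^sub>R (P k - P (Suc k)))"
    using half_cycle_expansion antipode[of "Suc _"] unfolding sum_lessThan_add
    by (simp add: slope_antipode antipode scaleR_diff_right sum_subtractf)
  also have "\<dots> = (\<Sum>k<?N. slope k *\<^sub>R P k) - (\<Sum>k<?N. slope k *\<^sub>R P (Suc k))"
    by (simp add: mult_2 scaleR_diff_right sum_subtractf)
  also have "(\<Sum>k<?N. slope k *\<^sub>R P k) = (\<Sum>k<?N. slope (Suc k) *\<^sub>R P (Suc k))"
    using sum_periodic_shift[of "\<lambda>k. slope k *\<^sub>R P k" ?N 1] by (simp add: slope_periodic periodic)
  also have "\<dots> - (\<Sum>k<?N. slope k *\<^sub>R P (Suc k)) = (\<Sum>k<?N. (slope (Suc k) - slope k) *\<^sub>R P (Suc k))"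
    by (simp add: scaleR_diff_left sum_subtractf)
  also have "\<dots> = 2 *\<^sub>R ?V - 2 *\<^sub>R (\<Sum>k<?N. of_bool (valley (k + CARD('n))) *\<^sub>R P (Suc k))"
    by (simp only: slope_diff scaleR_diff_left sum_subtractf scaleR_sum_right scaleR_scaleR)
  \<comment> \<open>The local maxima are rewritten as negated local minima; a shift by half the
    period then turns their sum into \<open>- ?V\<close>.\<close>
  also have "(\<Sum>k<?N. of_bool (valley (k + CARD('n))) *\<^sub>R P (Suc k))
      = - (\<Sum>k<?N. of_bool (valley (k + CARD('n))) *\<^sub>R P (Suc (k + CARD('n))))"
    using antipode[of "Suc _"] by (simp add: sum_negf)
  also have "(\<Sum>k<?N. of_bool (valley (k + CARD('n))) *\<^sub>R P (Suc (k + CARD('n)))) = ?V"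
  proof (rule sum_periodic_shift)
    show "of_bool (valley (k + ?N)) *\<^sub>R P (Suc (k + ?N)) = of_bool (valley k) *\<^sub>R P (Suc k)" for k
      using valley_periodic[of k] periodic[of "Suc k"] by simp
  qed
  also have "2 *\<^sub>R ?V - 2 *\<^sub>R - ?V = 4 *\<^sub>R ?V" by (simp flip: scaleR_left_distrib)
  finally show ?thesis by simp
qed

lemma inj_on_Suc: "inj_on (\<lambda>k. P (Suc k)) {k. k < 2 * CARD('n) \<and> valley k}"
  by (rule inj_onI) (auto simp: eq_iff mod_Suc split: if_splits)

lemma sum_valleys: "\<Sum>valleys = T"
proof -
  have "\<Sum>valleys = (\<Sum>k | k < 2 * CARD('n) \<and> valley k. P (Suc k))"
    unfolding valleys_def by (simp add: sum.reindex[OF inj_on_Suc])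
  also have "\<dots> = (\<Sum>k<2 * CARD('n). if valley k then P (Suc k) else 0)"
    by (subst sum.inter_filter[symmetric]) auto
  also have "\<dots> = (\<Sum>k<2 * CARD('n). of_bool (valley k) *\<^sub>R P (Suc k))"
    by (rule sum.cong) auto
  finally show ?thesis by (simp add: sum_valley_eq)
qed

text \<open>The squared jump is 4 at each local minimum and at each local maximum, and 0 elsewhere;
  there are equally many of both kinds.\<close>

lemma card_valleys: "8 * real (card valleys) = (\<Sum>k<2 * CARD('n). (slope (Suc k) - slope k)\<^sup>2)"
proof -
  let ?N = "2 * CARD('n)"
  have sq: "(slope (Suc k) - slope k)\<^sup>2 = 4 * of_bool (valley k) + 4 * of_bool (valley (k + CARD('n)))" for k
    using not_valley_antipode[of k] by (auto simp: slope_diff)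
  have "card valleys = card {k. k < ?N \<and> valley k}"
    unfolding valleys_def by (rule card_image[OF inj_on_Suc])
  also have "real \<dots> = (\<Sum>k<?N. of_bool (valley k))"
    by (simp add: of_bool_def sum.If_cases Int_def lessThan_def)
  finally have card: "real (card valleys) = (\<Sum>k<?N. of_bool (valley k))" .
  have "(\<Sum>k<?N. of_bool (valley (k + CARD('n)))) = (\<Sum>k<?N. of_bool (valley k) :: real)"
    by (rule sum_periodic_shift[of "\<lambda>k. of_bool (valley k)"]) (simp add: valley_periodic)
  with card show ?thesis
    by (simp add: sq sum.distrib flip: sum_distrib_left)
qed

lemma valleys_subset: "valleys \<subseteq> P ` {..<2 * CARD('n)}"
proof
  fix v assume "v \<in> valleys"
  then obtain k where "v = P (Suc k)" by (auto simp: valleys_def)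
  then have "v = P (Suc k mod (2 * CARD('n)))" by (simp add: eq_iff)
  then show "v \<in> P ` {..<2 * CARD('n)}" by simp
qed

lemma valleys_antipode_free:
  assumes "v \<in> valleys"
  shows "- v \<notin> valleys"
proof
  assume "- v \<in> valleys"
  with assms obtain j k where jk: "v = P (Suc k)" "- v = P (Suc j)" "valley k" "valley j"
    by (auto simp: valleys_def)
  then have "P (Suc j) = P (Suc (k + CARD('n)))" using antipode[of "Suc k"] by simp
  then have "j mod (2 * CARD('n)) = (k + CARD('n)) mod (2 * CARD('n))"
    unfolding eq_iff by (simp add: mod_Suc split: if_splits)
  then have "valley j = valley (k + CARD('n))"
    using periodic_mod[of valley, OF valley_periodic] by metis
  with jk not_valley_antipode show False by blast
qed

text \<open>An antipodal pair has sum 0 and could be dropped, so a minimal decomposition is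
  antipode-free. By \<open>antipode_free_sum_inject\<close>, only one antipode-free set of vertices
  sums to \<open>T\<close>.\<close>

lemma decomposition_set_eq: "decomposition_set T P = valleys"
proof -
  let ?B = "P ` {..<CARD('n)}"
  have vert: "cycle_vertices P = ?B \<union> uminus ` ?B"
    by (simp add: cycle_vertices_def vertices_eq)
  have valleys: "valleys \<subseteq> ?B \<union> uminus ` ?B"
    using valleys_subset by (simp only: vertices_eq)
  have unique: "Q = valleys"
    if "Q \<subseteq> cycle_vertices P" "\<And>v. v \<in> Q \<Longrightarrow> - v \<notin> Q" "\<Sum>Q = T" for Q
    using that valleys valleys_antipode_free sum_valleys unfolding vert
    by (intro antipode_free_sum_inject[OF independent_half]) auto
  show ?thesis
    unfolding decomposition_set_def
  proof (rule the_equality)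
    show "minimal_decomposition T P valleys"
      unfolding minimal_decomposition_def
    proof (intro conjI allI impI notI)
      show "valleys \<subseteq> cycle_vertices P" using valleys by (simp only: vert)
      show "\<Sum>valleys = T" by (rule sum_valleys)
      fix Q assume Q: "Q \<subset> valleys" "\<Sum>Q = T"
      \<comment> \<open>A subset of \<open>valleys\<close> is antipode-free as well, so uniqueness
        also gives minimality.\<close>
      have "Q = valleys"
        using Q valleys valleys_antipode_free by (intro unique) (auto simp: vert)
      with Q show False by blast
    qed
  next
    fix Q assume Q: "minimal_decomposition T P Q"
    then have sub: "Q \<subseteq> cycle_vertices P" and sum: "\<Sum>Q = T"
      and min: "\<And>Q'. Q' \<subset> Q \<Longrightarrow> \<Sum>Q' \<noteq> T"
      by (auto simp: minimal_decomposition_def)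
    have "- v \<notin> Q" if v: "v \<in> Q" for v
    proof
      assume neg: "- v \<in> Q"
      obtain k where "v = P k" using v sub by (auto simp: cycle_vertices_def)
      then have "v \<noteq> 0" using sign[of k] by auto
      then have "v \<noteq> - v" by (metis add_eq_0_iff scaleR_2 scaleR_eq_0_iff zero_neq_numeral)
      have "finite Q" using sub by (rule finite_subset) (simp add: cycle_vertices_def)
      then have "\<Sum>(Q - {v, - v}) = \<Sum>Q - \<Sum>{v, - v}"
        using v neg by (intro sum_diff) auto
      also have "\<dots> = T" using sum \<open>v \<noteq> - v\<close> by simp
      finally show False using min[of "Q - {v, - v}"] v by blast
    qed
    then show "Q = valleys" using unique sub sum by blast
  qed
qed

end

section \<open>Unrolling a symmetric cycle, and the four formulas\<close>

lemma symmetric_cycle_antipodal_cycle: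
  fixes L :: "(real ^ 'n::finite) set"
  assumes L: "simple_oriented_matroid L" and R: "symmetric_cycle L R"
  shows "antipodal_cycle (\<lambda>k. R (k mod (2 * CARD('n))))"
proof
  let ?N = "2 * CARD('n)"
  have topes: "R (k mod ?N) \<in> topes L" for k
    using R unfolding symmetric_cycle_def by simp
  show "R (k mod ?N) $ e = 1 \<or> R (k mod ?N) $ e = -1" for k e
    by (rule topes_sign[OF L topes])
  show "hamming_dist (R (k mod ?N)) (R (Suc k mod ?N)) = 1" for k
  proof -
    have "(R (k mod ?N), R ((k mod ?N + 1) mod ?N)) \<in> tope_adj L"
      using R unfolding symmetric_cycle_def by simp
    then show ?thesis by (simp add: mod_Suc_eq tope_adj_def hamming_dist_def)
  qed
  show "R ((k + CARD('n)) mod ?N) = - R (k mod ?N)" for k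
  proof -
    define r where "r = k mod ?N"
    have "r < ?N" by (simp add: r_def)
    have anti: "R (j + CARD('n)) = - R j" if "j < CARD('n)" for j
      using R that unfolding symmetric_cycle_def by blast
    have "(k + CARD('n)) mod ?N = (r + CARD('n)) mod ?N" by (simp add: r_def mod_add_left_eq)
    moreover have "R ((r + CARD('n)) mod ?N) = - R r"
    \<comment> \<open>Antipodes are given only for the first half; in the second half the index
      wraps around and the relation is read backwards.\<close>
    proof (cases "r < CARD('n)")
      case True
      then show ?thesis by (simp add: anti)
    next
      case False
      then have "r + CARD('n) = r - CARD('n) + ?N" by simp
      then have "(r + CARD('n)) mod ?N = r - CARD('n)"
        using \<open>r < ?N\<close> by (metis less_imp_diff_less mod_add_self2 mod_less)
      moreover have "R r = - R (r - CARD('n))"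
        using anti[of "r - CARD('n)"] False \<open>r < ?N\<close> by simp
      ultimately show ?thesis by simp
    qed
    ultimately show ?thesis by (simp add: r_def)
  qed
  have "inj_on R {..<?N}" using R unfolding symmetric_cycle_def by blast
  then show "inj_on (\<lambda>k. R (k mod ?N)) {..<?N}" by (simp add: inj_on_def)
qed

theorem proposition2p1:
  fixes L :: "(real ^ 'n::finite) set"
    and T :: "real ^ 'n"
    and R :: "nat \<Rightarrow> real ^ 'n"
    and t :: nat
  assumes t_card: "t = CARD('n)"
    and t_ge: "t \<ge> 2"
    and simple: "simple_oriented_matroid L"
    and cycle: "symmetric_cycle L R"
    and tope: "T \<in> topes L"
  defines "q \<equiv> real (card (decomposition_set T R))"
    and "a \<equiv> autocorrelation L T R"
  shows "q = real t - (1/4) * (a 0 - a 2) \<and>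
    q = (1/4) * (3 * a 0 - 4 * a 1 + a 2) \<and>
    q = real t / 2 + (1/4) * (a 0 - 2 * a 1 + a 2) \<and>
    q = 3 * real t / 4 + (1/4) * (- a 1 + a 2)"
proof -
  let ?N = "2 * CARD('n)"
  define P where "P k = R (k mod ?N)" for k
  interpret antipodal_cycle P
    unfolding P_def by (rule symmetric_cycle_antipodal_cycle[OF simple cycle])
  interpret antipodal_cycle_tope P T
    by unfold_locales (rule topes_sign[OF simple tope])
  define z where "z k = real (hamming_dist T (P k))" for k
  have z_per: "z (k + ?N) = z k" for k by (simp add: z_def periodic)
  \<comment> \<open>Decompositions depend on the cycle only through its vertex set, so
    \<open>R\<close> may be replaced by its periodic extension.\<close>
  have "cycle_vertices R = cycle_vertices P"
    unfolding cycle_vertices_def by (rule image_cong) (simp_all add: P_def)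
  then have "decomposition_set T R = valleys"
    using decomposition_set_eq unfolding decomposition_set_def minimal_decomposition_def by simp
  then have q: "8 * q = (\<Sum>k<?N. (slope (Suc k) - slope k)\<^sup>2)"
    unfolding q_def using card_valleys by simp
  have dist: "real (distance_vector L T R (k mod ?N)) = z k" for k
  proof -
    have "R (k mod ?N) \<in> topes L" using cycle unfolding symmetric_cycle_def by simp
    then show ?thesis
      by (simp add: distance_vector_def tope_dist_eq_hamming_dist[OF simple tope] z_def P_def)
  qed
  have a: "a m = (\<Sum>k<?N. z k * z (k + m))" for m
    unfolding a_def autocorrelation_def dist
  proof (rule sum.cong)
    fix k assume "k \<in> {..<?N}"
    then show "real (distance_vector L T R k) * z (k + m) = z k * z (k + m)"
      using dist[of k] by simp
  qed simp
  have slope_z: "slope k = z (k + 1) - z k" for k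
    using hamming_dist_diff[of k] by (simp add: z_def)
  have slope_sq: "(slope k)\<^sup>2 = 1" for k using slope_cases[of k] by auto
  \<comment> \<open>Each of the \<open>?N\<close> steps changes the distance by 1 or -1.\<close>
  have "2 * real t = (\<Sum>k<?N. (z (k + 1) - z k)\<^sup>2)"
    unfolding slope_z[symmetric] slope_sq by (simp add: t_card)
  also have "\<dots> = 2 * a 0 - 2 * a 1"
    unfolding a add_0_right by (rule sum_first_difference_squared[of z ?N, OF z_per])
  finally have first: "real t = a 0 - a 1" by simp
  have "slope (Suc k) - slope k = z (k + 2) - 2 * z (k + 1) + z k" for k
    by (simp add: slope_z)
  then have "8 * q = 6 * a 0 - 8 * a 1 + 2 * a 2"
    unfolding q a add_0_right by (simp only: sum_second_difference_squared[of z ?N, OF z_per])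
  \<comment> \<open>The four formulas differ by multiples of \<open>real t = a 0 - a 1\<close>:
    \<open>4 * q\<close> is written with 4, 0, 2 and 3 times \<open>real t\<close> split
    off.\<close>
  with first show ?thesis by (simp add: field_simps)
qed

end
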